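(* Let $G$ be a (finite) tree. Then the following statements hold: (1) $I(G;-1) = 1$ if and only if $G$ is reducible to $P_n$ with $n \equiv 5, 0 \pmod 6$ by an even number of odd moves, or to $P_n$ with $n \equiv 2, 3 \pmod 6$ by an odd number of odd moves; (2) $I(G;-1) = -1$ if and only if $G$ is reducible to $P_n$ with $n \equiv 5, 0 \pmod 6$ by an odd number of odd moves, or to $P_n$ with $n \equiv 2, 3 \pmod 6$ by an even number of odd moves.
   Context: All graphs are finite and simple. $P_n$ denotes the path on $n$ vertices. The independence polynomial of $G$ is $I(G;x)=\sum_{i\ge 0} s_i x^i$, where $s_i$ is the number of independent sets (sets of pairwise nonadjacent vertices) of size $i$ in $G$. A vertex $u$ of $G$ is a branching point if $\deg_G(u) > 2$, and a leaf if $\deg_G(u)=1$. For a branching point $u$, a pure branch at $u$ is a path starting at $u$ and ending at a leaf of $G$ such that every vertex of the path other than $u$ has degree at most $2$ in $G$. The length of a branch is its number of edges (equivalently, the number of its vertices other than $u$), and its type is the residue of its length modulo $3$ (so type $0$, $1$ or $2$). Removing a branch at $u$ means deleting all of its vertices except $u$. Moves at a branching point $u$ of $G$: (1) If there exist a pure branch of type $1$ and a pure branch of type $2$ at $u$, remove all vertices of $G$ except those belonging to these two branches (the vertex $u$ is kept). (2) If there are $t \ge 2$ pure branches of the same type at $u$, remove all but one of them, i.e. remove $t-1$ of them (the vertex $u$ is kept). (3) Remove one or more pure branches of type $0$ at $u$ (the vertex $u$ is kept). Odd and even moves: a move removing $t-1$ out of $t\ge 2$ pure branches of type $1$ at $u$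 is odd if the number of removed branches whose length is congruent to $4 \pmod 6$ is odd; a move removing $t-1$ out of $t \ge 2$ pure branches of type $2$ at $u$ is odd if the number of removed branches whose length is congruent to $2 \pmod 6$ is odd; a move removing pure branches of type $0$ at $u$ is odd if the number of removed branches whose length is congruent to $3 \pmod 6$ is odd. Every other move of kind (2) or (3) is even. Moves of kind (1) are not odd. $G$ is reducible to $H$ if $H$ (up to isomorphism) is obtained from $G$ by a finite (possibly empty) sequence of moves, each performed at a branching point of the current graph. "Reducible to $H$ by an even (respectively odd) number of odd moves" means that there is such a sequence of moves from $G$ to $H$ in which the number of odd moves is even (respectively odd); the sequence may also contain moves that are not odd. *)

theory Defs
  imports "HOL-Computational_Algebra.Polynomial"
begin

section \<open>Finite simple graphs\<close>

record 'a ugraph =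
  verts :: "'a set"
  edges :: "'a set set"

definition simple_graph :: "'a ugraph \<Rightarrow> bool" where
  "simple_graph G \<longleftrightarrow> finite (verts G) \<and>
     edges G \<subseteq> {{u, v} | u v. u \<in> verts G \<and> v \<in> verts G \<and> u \<noteq> v}"

definition adj :: "'a ugraph \<Rightarrow> 'a \<Rightarrow> 'a \<Rightarrow> bool" where
  "adj G u v \<longleftrightarrow> {u, v} \<in> edges G"

definition deg :: "'a ugraph \<Rightarrow> 'a \<Rightarrow> nat" where
  "deg G u = card {v. adj G u v}"

definition induced_subgraph :: "'a ugraph \<Rightarrow> 'a set \<Rightarrow> 'a ugraph" where
  "induced_subgraph G S = \<lparr>verts = verts G \<inter> S, edges = {e \<in> edges G. e \<subseteq> S}\<rparr>"

definition del_verts :: "'a ugraph \<Rightarrow> 'a set \<Rightarrow> 'a ugraph" where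
  "del_verts G S = induced_subgraph G (verts G - S)"

definition graph_iso :: "'a ugraph \<Rightarrow> 'b ugraph \<Rightarrow> bool" where
  "graph_iso G H \<longleftrightarrow> (\<exists>f. bij_betw f (verts G) (verts H) \<and>
     (\<forall>u\<in>verts G. \<forall>v\<in>verts G. adj G u v \<longleftrightarrow> adj H (f u) (f v)))"

text \<open>A path in a graph is its nonempty list of distinct vertices.\<close>

definition is_path :: "'a ugraph \<Rightarrow> 'a list \<Rightarrow> bool" where
  "is_path G p \<longleftrightarrow> p \<noteq> [] \<and> distinct p \<and> set p \<subseteq> verts G \<and> successively (adj G) p"

definition is_cycle :: "'a ugraph \<Rightarrow> 'a list \<Rightarrow> bool" where
  "is_cycle G c \<longleftrightarrow> is_path G c \<and> length c \<ge> 3 \<and> adj G (last c) (hd c)"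

definition connected_graph :: "'a ugraph \<Rightarrow> bool" where
  "connected_graph G \<longleftrightarrow> verts G \<noteq> {} \<and>
     (\<forall>u\<in>verts G. \<forall>v\<in>verts G. \<exists>p. is_path G p \<and> hd p = u \<and> last p = v)"

definition tree :: "'a ugraph \<Rightarrow> bool" where
  "tree G \<longleftrightarrow> simple_graph G \<and> connected_graph G \<and> \<not> (\<exists>c. is_cycle G c)"

definition path_graph :: "nat \<Rightarrow> nat ugraph" where
  "path_graph n = \<lparr>verts = {..<n}, edges = {{i, Suc i} | i. Suc i < n}\<rparr>"


section \<open>The independence polynomial\<close>

definition independent_set :: "'a ugraph \<Rightarrow> 'a set \<Rightarrow> bool" where
  "independent_set G S \<longleftrightarrow> S \<subseteq> verts G \<and> (\<forall>u\<in>S. \<forall>v\<in>S. \<not> adj G u v)"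

definition num_independent :: "'a ugraph \<Rightarrow> nat \<Rightarrow> nat" where
  "num_independent G i = card {S. independent_set G S \<and> card S = i}"

text \<open>No independent set has more than \<open>card (verts G)\<close> elements, so the sum may stop there.\<close>

definition indep_poly :: "'a ugraph \<Rightarrow> int poly" where
  "indep_poly G = (\<Sum>i\<le>card (verts G). monom (int (num_independent G i)) i)"


section \<open>Pure branches\<close>

definition branching_point :: "'a ugraph \<Rightarrow> 'a \<Rightarrow> bool" where
  "branching_point G u \<longleftrightarrow> u \<in> verts G \<and> deg G u > 2"

definition leaf :: "'a ugraph \<Rightarrow> 'a \<Rightarrow> bool" where
  "leaf G u \<longleftrightarrow> u \<in> verts G \<and> deg G u = 1"

text \<open>A branch at \<open>u\<close> is listed from \<open>u\<close> to its leaf, so distinct branches are distinct lists.\<close>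

definition pure_branch :: "'a ugraph \<Rightarrow> 'a \<Rightarrow> 'a list \<Rightarrow> bool" where
  "pure_branch G u p \<longleftrightarrow> branching_point G u \<and> is_path G p \<and> hd p = u \<and> leaf G (last p) \<and>
     (\<forall>v\<in>set p - {u}. deg G v \<le> 2)"

definition branch_length :: "'a list \<Rightarrow> nat" where
  "branch_length p = length p - 1"

definition branch_type :: "'a list \<Rightarrow> nat" where
  "branch_type p = branch_length p mod 3"

definition branches_of_type :: "'a ugraph \<Rightarrow> 'a \<Rightarrow> nat \<Rightarrow> 'a list set" where
  "branches_of_type G u t = {p. pure_branch G u p \<and> branch_type p = t}"

definition remove_branches :: "'a ugraph \<Rightarrow> 'a \<Rightarrow> 'a list set \<Rightarrow> 'a ugraph" where
  "remove_branches G u R = del_verts G ((\<Union>p\<in>R. set p) - {u})"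


section \<open>Moves and reducibility\<close>

definition odd_residue :: "nat \<Rightarrow> nat" where
  "odd_residue t = (if t = 0 then 3 else if t = 1 then 4 else 2)"

text \<open>Parity of a move that removes the set \<open>R\<close> of branches, all of them of type \<open>t\<close>.\<close>

definition odd_removal :: "nat \<Rightarrow> 'a list set \<Rightarrow> bool" where
  "odd_removal t R \<longleftrightarrow> odd (card {p \<in> R. branch_length p mod 6 = odd_residue t})"

text \<open>
  \<open>move G b H\<close>: a single move turns \<open>G\<close> into \<open>H\<close>, and \<open>b\<close> tells whether that move is odd.
  In \<open>same_type\<close>, all pure branches of type \<open>t\<close> at \<open>u\<close> but one are removed.
  When \<open>t = 0\<close> that move is also an instance of \<open>type_0\<close>, with the same parity.
\<close>

inductive move :: "'a ugraph \<Rightarrow> bool \<Rightarrow> 'a ugraph \<Rightarrow> bool" where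
  types_1_2: "branching_point G u \<Longrightarrow>
     p \<in> branches_of_type G u 1 \<Longrightarrow> q \<in> branches_of_type G u 2 \<Longrightarrow>
     move G False (induced_subgraph G (set p \<union> set q))"
| same_type: "branching_point G u \<Longrightarrow> t \<in> {0, 1, 2} \<Longrightarrow>
     card (branches_of_type G u t) \<ge> 2 \<Longrightarrow> p \<in> branches_of_type G u t \<Longrightarrow>
     R = branches_of_type G u t - {p} \<Longrightarrow>
     move G (odd_removal t R) (remove_branches G u R)"
| type_0: "branching_point G u \<Longrightarrow> R \<subseteq> branches_of_type G u 0 \<Longrightarrow> R \<noteq> {} \<Longrightarrow>
     move G (odd_removal 0 R) (remove_branches G u R)"

text \<open>\<open>moves G k H\<close>: a finite sequence of moves, exactly \<open>k\<close> of them odd, leads from \<open>G\<close> to \<open>H\<close>.\<close>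

inductive moves :: "'a ugraph \<Rightarrow> nat \<Rightarrow> 'a ugraph \<Rightarrow> bool" where
  refl: "moves G 0 G"
| step: "moves G k H \<Longrightarrow> move H b K \<Longrightarrow> moves G (k + of_bool b) K"

definition reducible_with :: "'a ugraph \<Rightarrow> nat \<Rightarrow> 'b ugraph \<Rightarrow> bool" where
  "reducible_with G k H \<longleftrightarrow> (\<exists>K. moves G k K \<and> graph_iso K H)"

definition reducible_by_even :: "'a ugraph \<Rightarrow> 'b ugraph \<Rightarrow> bool" where
  "reducible_by_even G H \<longleftrightarrow> (\<exists>k. even k \<and> reducible_with G k H)"

definition reducible_by_odd :: "'a ugraph \<Rightarrow> 'b ugraph \<Rightarrow> bool" where
  "reducible_by_odd G H \<longleftrightarrow> (\<exists>k. odd k \<and> reducible_with G k H)"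

end

(* If x is attached to the rest of a graph by a pendant path with k further vertices, then deleting
   the path turns I(G;-1) into a combination of I(G - path;-1) and I(G - path - x;-1) whose
   coefficients depend only on k mod 6. Hence every move multiplies I(G;-1) by 1 or -1, the sign
   being -1 exactly for odd moves (moves of kind (1) relate two graphs with value 0), and the values
   of P_0, P_1, ... are 1, 0, -1, -1, 0, 1, repeating with period 6. Conversely a tree with a
   branching point admits a move to a smaller tree: an end of a longest path between branching
   points carries two pure branches. So every tree reduces to some path, which determines its value. *)

theory Submission
  imports Defs
begin

section \<open>The alternating count of independent sets\<close>

text \<open>At -1 the deletion recurrence along a path has characteristic polynomial t^2 - t + 1,
  whose roots are the primitive sixth roots of unity: hence period 6, and period 3 up to sign. Let a
  and b be the values of a graph with the base vertex u kept and deleted. Attaching a branch of k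
  vertices at u turns a, up to sign, into a, a - b or b for k = 0, 1 or 2 modulo 3, which is the
  meaning of the type; the minus sign occurs at k = 3, 4, 2 modulo 6, the residues that define odd
  moves. Once a type 1 branch is present, deleting u gives 0; once a type 2 branch is present,
  deleting u changes nothing. The obstacle is that stripping branches one by one may leave u with
  degree at most 2, so that the remaining branches are no longer pure in the intermediate graphs.
  The count therefore takes a relation and a vertex set: adjacency stays that of the original graph
  and only the set shrinks. Different sequences of moves may end in different paths; the value at -1
  constrains all of them at once, and one reduction suffices for the converse.\<close>

definition alt_indep :: "('a \<Rightarrow> 'a \<Rightarrow> bool) \<Rightarrow> 'a set \<Rightarrow> int" where
  "alt_indep E A = (\<Sum>S | S \<subseteq> A \<and> (\<forall>u\<in>S. \<forall>v\<in>S. \<not> E u v). (- 1) ^ card S)"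

lemma poly_indep_poly_minus_one:
  assumes "finite (verts G)"
  shows "poly (indep_poly G) (- 1) = alt_indep (adj G) (verts G)"
proof -
  let ?I = "{S. independent_set G S}"
  have sub: "?I \<subseteq> Pow (verts G)"
    by (auto simp: independent_set_def)
  have fin: "finite ?I"
    using sub assms finite_subset by blast
  have "poly (indep_poly G) (- 1) =
      (\<Sum>i\<le>card (verts G). int (num_independent G i) * (- 1) ^ i)"
    by (simp add: indep_poly_def poly_sum poly_monom)
  also have "\<dots> = (\<Sum>i\<le>card (verts G). \<Sum>S | S \<in> ?I \<and> card S = i. (- 1) ^ card S)"
    by (simp add: num_independent_def)
  also have "\<dots> = (\<Sum>S\<in>?I. (- 1) ^ card S)"
    by (rule sum.group) (use fin sub assms in \<open>auto intro: card_mono\<close>)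
  finally show ?thesis
    by (simp add: alt_indep_def independent_set_def)
qed

lemma alt_indep_cong:
  assumes "\<And>u v. u \<in> A \<Longrightarrow> v \<in> A \<Longrightarrow> E u v \<longleftrightarrow> E' u v"
  shows "alt_indep E A = alt_indep E' A"
proof -
  have "{S. S \<subseteq> A \<and> (\<forall>u\<in>S. \<forall>v\<in>S. \<not> E u v)} = {S. S \<subseteq> A \<and> (\<forall>u\<in>S. \<forall>v\<in>S. \<not> E' u v)}"
    using assms by blast
  then show ?thesis
    by (simp add: alt_indep_def)
qed

lemma alt_indep_image:
  assumes inj: "inj_on f A" and E: "\<And>u v. u \<in> A \<Longrightarrow> v \<in> A \<Longrightarrow> E u v \<longleftrightarrow> E' (f u) (f v)"
  shows "alt_indep E A = alt_indep E' (f ` A)"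
proof -
  have indep: "(\<forall>u\<in>f ` S. \<forall>v\<in>f ` S. \<not> E' u v) \<longleftrightarrow> (\<forall>u\<in>S. \<forall>v\<in>S. \<not> E u v)" if "S \<subseteq> A" for S
    using E[OF subsetD[OF that] subsetD[OF that]] by simp
  have "(\<Sum>S | S \<subseteq> f ` A \<and> (\<forall>u\<in>S. \<forall>v\<in>S. \<not> E' u v). (- 1) ^ card S :: int) =
      (\<Sum>S\<in>(`) f ` {S. S \<subseteq> A \<and> (\<forall>u\<in>S. \<forall>v\<in>S. \<not> E u v)}. (- 1) ^ card S)"
  proof (rule sum.cong)
    have "T \<subseteq> f ` A \<and> (\<forall>u\<in>T. \<forall>v\<in>T. \<not> E' u v) \<longleftrightarrow>
        (\<exists>S. (S \<subseteq> A \<and> (\<forall>u\<in>S. \<forall>v\<in>S. \<not> E u v)) \<and> T = f ` S)" for T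
    proof
      assume T: "T \<subseteq> f ` A \<and> (\<forall>u\<in>T. \<forall>v\<in>T. \<not> E' u v)"
      then obtain S where "S \<subseteq> A" "T = f ` S"
        by (auto elim: subset_imageE)
      then show "\<exists>S. (S \<subseteq> A \<and> (\<forall>u\<in>S. \<forall>v\<in>S. \<not> E u v)) \<and> T = f ` S"
        using T indep[of S] by auto
    next
      assume "\<exists>S. (S \<subseteq> A \<and> (\<forall>u\<in>S. \<forall>v\<in>S. \<not> E u v)) \<and> T = f ` S"
      then obtain S where "S \<subseteq> A" "\<forall>u\<in>S. \<forall>v\<in>S. \<not> E u v" "T = f ` S"
        by blast
      then show "T \<subseteq> f ` A \<and> (\<forall>u\<in>T. \<forall>v\<in>T. \<not> E' u v)"
        using indep[of S] by auto
    qed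
    then show "{S. S \<subseteq> f ` A \<and> (\<forall>u\<in>S. \<forall>v\<in>S. \<not> E' u v)} =
        (`) f ` {S. S \<subseteq> A \<and> (\<forall>u\<in>S. \<forall>v\<in>S. \<not> E u v)}"
      unfolding image_def by simp
  qed simp
  also have "\<dots> = (\<Sum>S | S \<subseteq> A \<and> (\<forall>u\<in>S. \<forall>v\<in>S. \<not> E u v). (- 1) ^ card (f ` S))"
    by (subst sum.reindex) (auto intro: inj_on_subset[OF inj_on_image_Pow[OF inj]])
  also have "\<dots> = (\<Sum>S | S \<subseteq> A \<and> (\<forall>u\<in>S. \<forall>v\<in>S. \<not> E u v). (- 1) ^ card S)"
    by (rule sum.cong) (auto simp: card_image inj_on_subset[OF inj])
  finally show ?thesis
    by (simp add: alt_indep_def)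
qed

lemma alt_indep_graph_iso:
  assumes "graph_iso G H"
  shows "alt_indep (adj G) (verts G) = alt_indep (adj H) (verts H)"
proof -
  obtain f where f: "bij_betw f (verts G) (verts H)"
      "\<And>u v. u \<in> verts G \<Longrightarrow> v \<in> verts G \<Longrightarrow> adj G u v \<longleftrightarrow> adj H (f u) (f v)"
    using assms by (auto simp: graph_iso_def)
  then show ?thesis
    using alt_indep_image[of f "verts G" "adj G" "adj H"] by (simp add: bij_betw_def)
qed

text \<open>Independent sets containing \<open>v\<close> correspond, by dropping \<open>v\<close>,
  to those that avoid its neighbours; losing one element flips the sign.\<close>

lemma alt_indep_insert:
  assumes fin: "finite A" and v: "v \<notin> A" and E: "symp E" "irreflp E"
  shows "alt_indep E (insert v A) = alt_indep E A - alt_indep E (A - {y. E v y})"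
proof -
  let ?I = "\<lambda>A. {S. S \<subseteq> A \<and> (\<forall>u\<in>S. \<forall>v\<in>S. \<not> E u v)}"
  let ?B = "A - {y. E v y}"
  have eq: "?I (insert v A) = ?I A \<union> insert v ` ?I ?B"
  proof (intro equalityI subsetI)
    fix S assume S: "S \<in> ?I (insert v A)"
    show "S \<in> ?I A \<union> insert v ` ?I ?B"
    proof (cases "v \<in> S")
      case True
      then have "S = insert v (S - {v})" "S - {v} \<in> ?I ?B"
        using S by auto
      then show ?thesis by blast
    qed (use S in auto)
  next
    fix S assume "S \<in> ?I A \<union> insert v ` ?I ?B"
    then consider "S \<in> ?I A" | T where "T \<in> ?I ?B" "S = insert v T"
      by blast
    then show "S \<in> ?I (insert v A)"
    proof cases
      case 2
      then have "\<not> E v y \<and> \<not> E y v" if "y \<in> T" for y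
        using that sympD[OF E(1)] by blast
      then show ?thesis
        using 2 irreflpD[OF E(2)] by blast
    qed blast
  qed
  have f: "finite (?I A)" "finite (?I ?B)"
    using fin by (auto intro: finite_subset[of _ "Pow A"])
  have inj: "inj_on (insert v) (?I ?B)"
    using v by (intro inj_on_inverseI[where g = "\<lambda>S. S - {v}"]) auto
  have "alt_indep E (insert v A) = alt_indep E A + (\<Sum>S\<in>insert v ` ?I ?B. (- 1) ^ card S)"
    unfolding alt_indep_def eq using f v by (intro sum.union_disjoint) auto
  also have "(\<Sum>S\<in>insert v ` ?I ?B. (- 1) ^ card S) = (\<Sum>S\<in>?I ?B. (- 1) ^ card (insert v S) :: int)"
    using inj by (simp add: sum.reindex)
  also have "\<dots> = (\<Sum>S\<in>?I ?B. - ((- 1) ^ card S))"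
  proof (rule sum.cong)
    fix S assume "S \<in> ?I ?B"
    then have "finite S" "v \<notin> S"
      using fin v finite_subset by auto
    then show "(- 1) ^ card (insert v S) = - ((- 1) ^ card S :: int)"
      by simp
  qed simp
  finally show ?thesis
    by (simp add: alt_indep_def sum_negf)
qed


section \<open>Pendant paths\<close>

text \<open>The six-periodic sequence \<open>0, 1, 1, 0, -1, -1\<close>; the path on \<open>n\<close> vertices has
  alternating count \<open>period_six (n + 2)\<close>.\<close>

fun period_six :: "nat \<Rightarrow> int" where
  "period_six 0 = 0"
| "period_six (Suc 0) = 1"
| "period_six (Suc (Suc n)) = period_six (Suc n) - period_six n"

lemma period_six_eq:
  "period_six n = (if n mod 6 \<in> {1, 2} then 1 else if n mod 6 \<in> {4, 5} then - 1 else 0)"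
proof -
  have per: "period_six (n + 6) = period_six n" for n
    by (simp add: numeral_eq_Suc)
  have "period_six (r + 6 * m) = period_six r" for r m
  proof (induction m)
    case (Suc m)
    have "r + 6 * Suc m = (r + 6 * m) + 6"
      by simp
    then show ?case
      using per[of "r + 6 * m"] Suc by (simp only:)
  qed simp
  from this[of "n mod 6" "n div 6"] have "period_six n = period_six (n mod 6)"
    by simp
  moreover have "n mod 6 = 0 \<or> n mod 6 = 1 \<or> n mod 6 = 2 \<or> n mod 6 = 3 \<or> n mod 6 = 4 \<or> n mod 6 = 5"
    by presburger
  moreover have "period_six 1 = 1" "period_six 2 = 1" "period_six 3 = 0"
    "period_six 4 = - 1" "period_six 5 = - 1"
    by (simp_all add: numeral_eq_Suc)
  ultimately show ?thesis
    by (elim disjE) simp_all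
qed

text \<open>The path is grown outwards from \<open>x\<close>, in step with the deletion recurrence.
  Only neighbours inside the current set are constrained, so the property survives shrinking
  \<open>X\<close>, even by \<open>x\<close> itself.\<close>

fun attached :: "('a \<Rightarrow> 'a \<Rightarrow> bool) \<Rightarrow> 'a set \<Rightarrow> 'a \<Rightarrow> 'a list \<Rightarrow> bool" where
  "attached E X x [] \<longleftrightarrow> True"
| "attached E X x (v # q) \<longleftrightarrow> v \<notin> X \<and> E v x \<and> (\<forall>y\<in>X. E v y \<longrightarrow> y = x) \<and> attached E (insert v X) v q"

text \<open>The base vertex \<open>x\<close> need not lie in \<open>X\<close>: deleting it leaves a detached path, for which the
  same formula holds.\<close>

lemma alt_indep_attached:
  assumes "symp E" "irreflp E" "finite X" "attached E X x q"
  shows "alt_indep E (X \<union> set q) =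
    period_six (Suc (length q)) * alt_indep E X - period_six (length q) * alt_indep E (X - {x})"
  using assms(3,4)
proof (induction q arbitrary: X x)
  case (Cons v q)
  \<comment> \<open>If \<open>x\<close> is not in \<open>X\<close>, then \<open>v\<close> has no
    neighbour in \<open>X\<close> and both sides are \<open>X\<close>.\<close>
  have "X - {y. E v y} = X - {x}"
    using Cons.prems by auto
  then have "alt_indep E (insert v X) = alt_indep E X - alt_indep E (X - {x})"
    using alt_indep_insert[of X v E] assms(1,2) Cons.prems by simp
  moreover have "alt_indep E (insert v X \<union> set q) = period_six (Suc (length q)) * alt_indep E (insert v X)
      - period_six (length q) * alt_indep E (insert v X - {v})"
    using Cons.prems by (intro Cons.IH) auto
  moreover have "insert v X - {v} = X" "X \<union> set (v # q) = insert v X \<union> set q"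
    using Cons.prems by auto
  \<comment> \<open>With a and b the values on \<open>X\<close> and \<open>X - {x}\<close>, k the
    length of \<open>q\<close> and f the sequence, this is f(k+1) (a - b) - f(k) a = f(k+2) a -
    f(k+1) b.\<close>
  ultimately show ?case
    by (simp only: list.size period_six.simps) (simp add: algebra_simps)
qed simp

lemma attached_mono:
  "attached E X x q \<Longrightarrow> Y \<subseteq> X \<Longrightarrow> attached E Y x q"
proof (induction q arbitrary: X Y x)
  case (Cons v q)
  then have "attached E (insert v Y) v q"
    using Cons.IH[of "insert v X" v "insert v Y"] by auto
  then show ?case
    using Cons.prems by auto
qed simp

lemma attached_adj:
  "attached E X x q \<Longrightarrow> y \<in> set q \<Longrightarrow> z \<in> X \<Longrightarrow> E y z \<Longrightarrow> z = x \<and> y = hd q"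
proof (induction q arbitrary: X x)
  case (Cons v q)
  show ?case
  proof (cases "y = v")
    case False
    \<comment> \<open>This is the contradictory case, because \<open>z\<close> lies in
      \<open>X\<close> and \<open>v\<close> does not.\<close>
    then have "z = v"
      using Cons.IH[of "insert v X" v] Cons.prems by auto
    then show ?thesis
      using Cons.prems by auto
  qed (use Cons.prems in auto)
qed simp

text \<open>\<open>period_six\<close> vanishes at multiples of 3, which kills the term without
  \<open>u\<close>; the other coefficient is the sign.\<close>

lemma alt_indep_type_0:
  assumes "symp E" "irreflp E" "finite X" "attached E X u q" "length q mod 3 = 0"
  shows "alt_indep E (X \<union> set q) = (if length q mod 6 = odd_residue 0 then - 1 else 1) * alt_indep E X"
proof -
  have "length q mod 6 = 0 \<or> length q mod 6 = 3"
    using assms(5) by presburger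
  then have "period_six (length q) = 0"
    "period_six (Suc (length q)) = (if length q mod 6 = 3 then - 1 else 1)"
    by (auto simp: period_six_eq mod_Suc simp del: period_six.simps)
  then show ?thesis
    using alt_indep_attached[OF assms(1-4)] by (simp add: odd_residue_def)
qed

text \<open>With \<open>u\<close> deleted the branch is a detached path: both terms of the formula
  involve the same set, and for type 1 their coefficients cancel.\<close>

lemma alt_indep_type_1_delete:
  assumes "symp E" "irreflp E" "finite Y" "attached E Y u q" "u \<notin> set q" "length q mod 3 = 1"
  shows "alt_indep E (Y \<union> set q - {u}) = 0"
proof -
  have "length q mod 6 = 1 \<or> length q mod 6 = 4"
    using assms(6) by presburger
  then have "period_six (length q) = period_six (Suc (length q))"
    by (auto simp: period_six_eq mod_Suc simp del: period_six.simps)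
  moreover have "alt_indep E (Y - {u} \<union> set q) = period_six (Suc (length q)) * alt_indep E (Y - {u})
      - period_six (length q) * alt_indep E (Y - {u} - {u})"
    using assms by (intro alt_indep_attached) (auto intro: attached_mono)
  moreover have "Y \<union> set q - {u} = Y - {u} \<union> set q"
    using assms(5) by auto
  ultimately show ?thesis
    by simp
qed

text \<open>Here the coefficient of \<open>X\<close> is the one that vanishes, so a type 2 branch
  acts like the deletion of its base vertex, up to sign.\<close>

lemma alt_indep_type_2:
  assumes "symp E" "irreflp E" "finite X" "attached E X u q" "length q mod 3 = 2"
  shows "alt_indep E (X \<union> set q) =
    (if length q mod 6 = odd_residue 2 then - 1 else 1) * alt_indep E (X - {u})"
proof -
  have "length q mod 6 = 2 \<or> length q mod 6 = 5"
    using assms(5) by presburger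
  then have "period_six (Suc (length q)) = 0"
    "period_six (length q) = (if length q mod 6 = 2 then 1 else - 1)"
    by (auto simp: period_six_eq mod_Suc simp del: period_six.simps)
  then show ?thesis
    using alt_indep_attached[OF assms(1-4)] by (simp add: odd_residue_def)
qed

text \<open>The type 2 branch \<open>q\<close> amounts to deleting \<open>u\<close>, and in the
  presence of the type 1 branch \<open>p\<close> that deletion gives 0.\<close>

lemma alt_indep_types_1_2:
  assumes "symp E" "irreflp E" "finite Y" "u \<notin> set p"
    and "attached E Y u p" "length p mod 3 = 1"
    and "attached E (Y \<union> set p) u q" "length q mod 3 = 2"
  shows "alt_indep E (Y \<union> set p \<union> set q) = 0"
  using assms by (simp add: alt_indep_type_2 alt_indep_type_1_delete)

text \<open>The surviving branch \<open>p\<close> does the work. For type 1 it makes the term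
  without \<open>u\<close> vanish, so \<open>q\<close> contributes a bare sign. For type 2,
  \<open>q\<close> deletes \<open>u\<close>, but \<open>p\<close> has already made the value
  indifferent to that deletion.\<close>

lemma alt_indep_twin_branch:
  assumes E: "symp E" "irreflp E" and fin: "finite Y" and u: "u \<notin> set p"
    and p: "attached E Y u p" "length p mod 3 = t"
    and q: "attached E (Y \<union> set p) u q" "length q mod 3 = t"
    and t: "t \<in> {1, 2}"
  shows "alt_indep E (Y \<union> set p \<union> set q) =
    (if length q mod 6 = odd_residue t then - 1 else 1) * alt_indep E (Y \<union> set p)"
proof (cases "t = 1")
  case True
  then have "length q mod 6 = 1 \<or> length q mod 6 = 4"
    using q(2) by presburger
  then have "period_six (Suc (length q)) = (if length q mod 6 = 4 then - 1 else 1)"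
    by (auto simp: period_six_eq mod_Suc simp del: period_six.simps)
  moreover have "alt_indep E (Y \<union> set p - {u}) = 0"
    using alt_indep_type_1_delete[OF E fin p(1) u] p(2) True by simp
  ultimately show ?thesis
    using alt_indep_attached[OF E _ q(1)] fin True by (simp add: odd_residue_def)
next
  case False
  then have t2: "t = 2"
    using t by simp
  have "attached E (Y - {u}) u p"
    using p(1) by (rule attached_mono) auto
  moreover have "Y \<union> set p - {u} = Y - {u} \<union> set p"
    using u by auto
  ultimately have "alt_indep E (Y \<union> set p - {u}) = alt_indep E (Y \<union> set p)"
    using alt_indep_type_2[OF E, of Y u p] alt_indep_type_2[OF E, of "Y - {u}" u p] fin p t2 by simp
  then show ?thesis
    using alt_indep_type_2[OF E _ q(1)] fin q(2) t2 by simp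
qed


section \<open>Pure branches as pendant paths\<close>

lemma adj_sym: "adj G u v \<longleftrightarrow> adj G v u"
  by (simp add: adj_def insert_commute)

lemma symp_adj: "symp (adj G)"
  by (rule sympI) (simp add: adj_sym)

lemma adj_verts:
  assumes "simple_graph G" "adj G u v"
  shows "u \<in> verts G" "v \<in> verts G" "u \<noteq> v"
  using assms unfolding simple_graph_def adj_def by (auto simp: doubleton_eq_iff)

lemma irreflp_adj: "simple_graph G \<Longrightarrow> irreflp (adj G)"
  by (rule irreflpI) (auto dest: adj_verts(3))

lemma finite_neighbours: "simple_graph G \<Longrightarrow> finite {v. adj G u v}"
  by (rule finite_subset[of _ "verts G"]) (auto dest: adj_verts(2), simp add: simple_graph_def)

lemma verts_induced_subgraph [simp]: "verts (induced_subgraph G S) = verts G \<inter> S"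
  by (simp add: induced_subgraph_def)

lemma adj_induced_subgraph [simp]: "adj (induced_subgraph G S) u v \<longleftrightarrow> adj G u v \<and> u \<in> S \<and> v \<in> S"
  by (auto simp: induced_subgraph_def adj_def)

lemma simple_graph_induced_subgraph: "simple_graph G \<Longrightarrow> simple_graph (induced_subgraph G S)"
  unfolding simple_graph_def induced_subgraph_def
  by (clarsimp simp: subset_eq) (metis insertCI)

text \<open>In contrast to \<open>attached\<close>, full neighbourhoods are prescribed and no base
  set occurs. Hence one such path is attached to every disjoint set, and its first vertex determines
  the rest.\<close>

inductive pendant :: "('a \<Rightarrow> 'a \<Rightarrow> bool) \<Rightarrow> 'a \<Rightarrow> 'a list \<Rightarrow> bool" for E where
  pendant_end: "{y. E v y} = {x} \<Longrightarrow> pendant E x [v]"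
| pendant_step: "{y. E v y} = {x, w} \<Longrightarrow> x \<noteq> w \<Longrightarrow> pendant E v (w # q) \<Longrightarrow> pendant E x (v # w # q)"

text \<open>The predecessor and the successor on the path already exhaust a neighbourhood of size at
  most 2.\<close>

lemma pendantI:
  assumes G: "simple_graph G"
  shows "successively (adj G) (x # q) \<Longrightarrow> distinct (x # q) \<Longrightarrow> q \<noteq> [] \<Longrightarrow> deg G (last q) = 1 \<Longrightarrow>
    (\<And>v. v \<in> set q \<Longrightarrow> deg G v \<le> 2) \<Longrightarrow> pendant (adj G) x q"
proof (induction q arbitrary: x)
  case (Cons v q)
  have vx: "adj G v x"
    using Cons.prems(1) by (simp add: adj_sym[of G v x])
  show ?case
  proof (cases q)
    case Nil
    then have "card {y. adj G v y} = 1"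
      using Cons.prems(4) by (simp add: deg_def)
    then obtain z where "{y. adj G v y} = {z}"
      by (auto simp: card_1_singleton_iff)
    then have "{y. adj G v y} = {x}"
      using vx by (metis mem_Collect_eq singletonD)
    then show ?thesis
      using Nil by (simp add: pendant_end)
  next
    case (Cons w r)
    have "adj G v w" "x \<noteq> w"
      using Cons.prems(1,2) Cons by auto
    then have "{x, w} \<subseteq> {y. adj G v y}" "card {x, w} = 2"
      using vx by auto
    moreover have "card {y. adj G v y} \<le> 2"
      using Cons.prems(5)[of v] by (simp add: deg_def)
    ultimately have "{y. adj G v y} = {x, w}"
      using card_seteq[OF finite_neighbours[OF G]] by metis
    moreover have "pendant (adj G) v q"
      using Cons Cons.prems by (intro Cons.IH) auto
    ultimately show ?thesis
      using Cons \<open>x \<noteq> w\<close> by (auto intro: pendant_step)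
  qed
qed simp

lemma pendant_attached:
  "pendant E x q \<Longrightarrow> distinct (x # q) \<Longrightarrow> X \<inter> set q = {} \<Longrightarrow> attached E X x q"
proof (induction arbitrary: X rule: pendant.induct)
  case (pendant_step v x w q)
  have "attached E (insert v X) v (w # q)"
    using pendant_step.prems by (intro pendant_step.IH) auto
  then show ?case
    using pendant_step by auto
qed auto

text \<open>Apart from the vertex the path came from, each neighbourhood has at most one element,
  which forces both the next vertex and the place where the path stops.\<close>

lemma pendant_unique:
  "pendant E x p \<Longrightarrow> pendant E x q \<Longrightarrow> hd p = hd q \<Longrightarrow> p = q"
proof (induction arbitrary: q rule: pendant.induct)
  case (pendant_end v x)
  from pendant_end(2,3,1) show ?case
    by (cases rule: pendant.cases) (auto simp: doubleton_eq_iff)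
next
  case (pendant_step v x w p)
  from pendant_step.prems(1) show ?case
  proof (cases rule: pendant.cases)
    case (pendant_end v')
    then show ?thesis
      using pendant_step by auto
  next
    case (pendant_step v' w' r)
    then have "v' = v" "w' = w"
      using pendant_step.prems pendant_step.hyps by auto
    then show ?thesis
      using pendant_step.IH[of "w # r"] pendant_step by auto
  qed
qed

lemma pure_branchD:
  assumes G: "simple_graph G" and p: "pure_branch G u p"
  shows "p = u # tl p" "tl p \<noteq> []" "distinct p" "set p \<subseteq> verts G" "u \<in> verts G"
    and "pendant (adj G) u (tl p)" "successively (adj G) p"
proof -
  note defs = pure_branch_def is_path_def branching_point_def leaf_def
  show u: "p = u # tl p"
    using p by (cases p) (auto simp: defs)
  show ne: "tl p \<noteq> []"
  proof
    assume "tl p = []"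
    \<comment> \<open>Then \<open>u\<close> would be a leaf as well as a branching point.\<close>
    then have "p = [u]"
      using u by simp
    then show False
      using p by (auto simp: defs)
  qed
  show "distinct p" "set p \<subseteq> verts G" "u \<in> verts G" "successively (adj G) p"
    using p by (auto simp: defs)
  show "pendant (adj G) u (tl p)"
  proof (rule pendantI[OF G])
    show "successively (adj G) (u # tl p)" "distinct (u # tl p)"
      using u p by (auto simp: defs)
    have "last p = last (tl p)"
      using u ne by (metis last_ConsR)
    then show "deg G (last (tl p)) = 1"
      using p by (auto simp: defs)
    show "deg G v \<le> 2" if "v \<in> set (tl p)" for v
    proof -
      have "v \<in> set p - {u}"
        using that u \<open>distinct (u # tl p)\<close> by (metis Diff_iff distinct.simps(2) empty_iff insert_iff list.set(2))
      then show ?thesis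
        using p by (auto simp: defs)
    qed
  qed (rule ne)
qed

lemma set_pure_branch:
  assumes "simple_graph G" "pure_branch G u p"
  shows "set p = insert u (set (tl p))" "u \<notin> set (tl p)" "set p - {u} = set (tl p)"
proof -
  obtain q where "p = u # q"
    using pure_branchD(1)[OF assms] by blast
  then show "set p = insert u (set (tl p))" "u \<notin> set (tl p)" "set p - {u} = set (tl p)"
    using pure_branchD(3)[OF assms] by auto
qed

lemma Union_pure_branches:
  assumes "simple_graph G" "\<And>p. p \<in> R \<Longrightarrow> pure_branch G u p"
  shows "(\<Union>p\<in>R. set p) - {u} = (\<Union>p\<in>R. set (tl p))"
proof -
  have "(\<Union>p\<in>R. set p) - {u} = (\<Union>p\<in>R. set p - {u})"
    by blast
  then show ?thesis
    using set_pure_branch(3)[OF assms(1)] assms(2) by simp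
qed

lemma branch_length_eq: "branch_length p = length (tl p)"
  by (simp add: branch_length_def)

lemma pure_branch_attached:
  assumes "simple_graph G" "pure_branch G u p" "X \<inter> set (tl p) = {}"
  shows "attached (adj G) X u (tl p)"
  using pure_branchD[OF assms(1,2)] assms(3) by (metis pendant_attached)

lemma pure_branch_adj:
  assumes G: "simple_graph G" and p: "pure_branch G u p"
    and y: "y \<in> set (tl p)" and z: "z \<notin> set (tl p)" and yz: "adj G y z"
  shows "z = u" "y = hd (tl p)"
proof -
  have "attached (adj G) (verts G - set (tl p)) u (tl p)"
    using pure_branch_attached[OF G p] by blast
  then have "z = u \<and> y = hd (tl p)"
    using attached_adj[of "adj G" _ u "tl p" y z] y z yz adj_verts(2)[OF G yz] by blast
  then show "z = u" "y = hd (tl p)"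
    by auto
qed

text \<open>Entering \<open>tl p\<close> along \<open>q\<close> is possible only from \<open>u\<close>, and a pure branch is
  determined by its first edge.\<close>

lemma pure_branches_disjoint:
  assumes G: "simple_graph G" and p: "pure_branch G u p" and q: "pure_branch G u q" and ne: "p \<noteq> q"
  shows "set (tl p) \<inter> set (tl q) = {}"
proof (rule ccontr)
  assume "set (tl p) \<inter> set (tl q) \<noteq> {}"
  then obtain b1 y b2 where b: "tl q = b1 @ y # b2" "y \<in> set (tl p)" "\<forall>z\<in>set b1. z \<notin> set (tl p)"
    using split_list_first_prop[of "tl q" "\<lambda>z. z \<in> set (tl p)"] by blast
  note qd = pure_branchD[OF G q] and pd = pure_branchD[OF G p]
  \<comment> \<open>The vertex just before \<open>y\<close> on \<open>q\<close>; it is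
    \<open>u\<close> itself when \<open>b1\<close> is empty.\<close>
  let ?z = "last (u # b1)"
  have q_eq: "q = (u # b1) @ y # b2"
    using qd(1) b(1) by simp
  then have "adj G ?z y"
    using qd(7) by (cases b1) (auto simp: successively_append_iff successively_Cons)
  moreover have "?z \<notin> set (tl p)"
    using b(3) set_pure_branch(2)[OF G p] by auto
  ultimately have zy: "?z = u" "y = hd (tl p)"
    using pure_branch_adj[OF G p b(2)] adj_sym by metis+
  \<comment> \<open>\<open>u\<close> occurs only at the head of \<open>q\<close>, so
    \<open>q\<close> enters the other branch with its first edge.\<close>
  have "b1 = []"
  proof (rule ccontr)
    assume "b1 \<noteq> []"
    then have "u \<in> set b1"
      using zy(1) by (metis last_ConsR last_in_set)
    then show False
      using qd(3) q_eq by auto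
  qed
  then have "tl p = tl q"
    using pendant_unique[OF pd(6) qd(6)] b(1) zy(2) by simp
  then show False
    using ne pd(1) qd(1) by simp
qed

lemma branches_of_typeD:
  assumes "p \<in> branches_of_type G u t"
  shows "pure_branch G u p" "length (tl p) mod 3 = t"
  using assms by (auto simp: branches_of_type_def branch_type_def branch_length_eq)

lemma finite_branches_of_type:
  assumes "simple_graph G"
  shows "finite (branches_of_type G u t)"
proof (rule finite_subset)
  show "branches_of_type G u t \<subseteq> {p. set p \<subseteq> verts G \<and> distinct p}"
    by (auto simp: branches_of_type_def pure_branch_def is_path_def)
  show "finite {p. set p \<subseteq> verts G \<and> distinct p}"
    using assms by (intro finite_subset_distinct) (simp add: simple_graph_def)
qed


section \<open>Moves change the alternating count only in sign\<close>

text \<open>The induction on \<open>R\<close> compares two vertex sets that differ by one branch,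
  always with the adjacency of \<open>G\<close>, where every member of \<open>R\<close> is pure. For
  types 1 and 2 the kept branch \<open>p0\<close> is the twin at each step.\<close>

lemma alt_indep_remove_branches:
  assumes G: "simple_graph G" and fin: "finite R" and R: "R \<subseteq> branches_of_type G u t"
    and t: "t = 0 \<or> t \<in> {1, 2} \<and> p0 \<in> branches_of_type G u t - R"
  shows "alt_indep (adj G) (verts G) =
    (if odd_removal t R then - 1 else 1) * alt_indep (adj G) (verts G - ((\<Union>p\<in>R. set p) - {u}))"
  using fin R t
proof (induction R rule: finite_induct)
  case empty
  then show ?case
    by (simp add: odd_removal_def)
next
  case (insert p R)
  let ?V = "\<lambda>R. verts G - ((\<Union>p\<in>R. set p) - {u})"
  let ?X = "?V (insert p R)"
  note E = symp_adj[of G] irreflp_adj[OF G]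
  have R: "q \<in> branches_of_type G u t" "pure_branch G u q" if "q \<in> insert p R" for q
    using that insert.prems(1) branches_of_typeD(1)[of q G u t] by auto
  have p: "pure_branch G u p" "length (tl p) mod 3 = t"
    using R[of p] branches_of_typeD(2)[of p G u t] by auto
  have finX: "finite ?X"
    using G by (simp add: simple_graph_def)
  have disj: "set (tl p) \<inter> set (tl q) = {}" if "q \<in> R" for q
    using that insert.hyps(2) R by (intro pure_branches_disjoint[OF G p(1)]) auto
  have V: "?V R = ?X \<union> set (tl p)"
  proof -
    let ?B = "\<Union>q\<in>R. set (tl q)"
    have R_eq: "(\<Union>q\<in>R. set q) - {u} = ?B"
      using R by (intro Union_pure_branches[OF G]) auto
    have "(\<Union>q\<in>insert p R. set q) - {u} = (\<Union>q\<in>insert p R. set (tl q))"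
      using R by (intro Union_pure_branches[OF G]) auto
    then have insert_eq: "(\<Union>q\<in>insert p R. set q) - {u} = set (tl p) \<union> ?B"
      by (simp only: UN_insert)
    have "set (tl p) \<subseteq> verts G"
      using pure_branchD(4)[OF G p(1)] set_pure_branch(1)[OF G p(1)] by blast
    moreover have "set (tl p) \<inter> ?B = {}"
      using disj by blast
    ultimately have "verts G - ?B = (verts G - (set (tl p) \<union> ?B)) \<union> set (tl p)"
      by blast
    then show ?thesis
      by (simp only: R_eq insert_eq)
  qed
  have step: "alt_indep (adj G) (?X \<union> set (tl p)) =
      (if length (tl p) mod 6 = odd_residue t then - 1 else 1) * alt_indep (adj G) ?X"
  proof (cases "t = 0")
    case True
    have "attached (adj G) ?X u (tl p)"
      using set_pure_branch(3)[OF G p(1)] by (intro pure_branch_attached[OF G p(1)]) auto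
    then show ?thesis
      using alt_indep_type_0[OF E finX] p(2) True by simp
  next
    case False
    then have t: "t \<in> {1, 2}" and "p0 \<in> branches_of_type G u t - insert p R"
      using insert.prems by auto
    then have p0: "pure_branch G u p0" "length (tl p0) mod 3 = t" "p0 \<noteq> p" "p0 \<notin> R"
      using branches_of_typeD by auto
    have disj0: "set (tl p0) \<inter> set (tl q) = {}" if "q \<in> insert p R" for q
      using that p0 R[of q] by (intro pure_branches_disjoint[OF G p0(1)]) auto
    have "set (tl p0) \<subseteq> ?X"
    proof
      fix y assume y: "y \<in> set (tl p0)"
      have "y \<notin> set q - {u}" if "q \<in> insert p R" for q
        using y disj0[OF that] set_pure_branch(3)[OF G R(2)[OF that]] by blast
      then show "y \<in> ?X"
        using y set_pure_branch(1)[OF G p0(1)] pure_branchD(4)[OF G p0(1)] by blast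
    qed
    \<comment> \<open>Splitting off the surviving branch exposes the base set to which both twins
      are attached.\<close>
    then have X: "?X = ?X - set (tl p0) \<union> set (tl p0)"
      by blast
    have "attached (adj G) (?X - set (tl p0)) u (tl p0)"
      by (intro pure_branch_attached[OF G p0(1)]) auto
    moreover have "attached (adj G) (?X - set (tl p0) \<union> set (tl p0)) u (tl p)"
      unfolding X[symmetric] using set_pure_branch(3)[OF G p(1)]
      by (intro pure_branch_attached[OF G p(1)]) auto
    ultimately show ?thesis
      using alt_indep_twin_branch[OF E _ set_pure_branch(2)[OF G p0(1)] _ p0(2) _ p(2) t,
          of "?X - set (tl p0)"] finX X by simp
  qed
  \<comment> \<open>The counted set gains \<open>p\<close> or stays as it is, so the parity flips
    exactly when the sign in \<open>step\<close> is negative.\<close>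
  have "{q \<in> insert p R. branch_length q mod 6 = odd_residue t} =
      (if length (tl p) mod 6 = odd_residue t then insert p else id)
        {q \<in> R. branch_length q mod 6 = odd_residue t}"
    by (auto simp: branch_length_eq)
  then have odd: "odd_removal t (insert p R) \<longleftrightarrow>
      (odd_removal t R \<longleftrightarrow> length (tl p) mod 6 \<noteq> odd_residue t)"
    using insert.hyps by (simp add: odd_removal_def)
  have "alt_indep (adj G) (verts G) =
      (if odd_removal t R then - 1 else 1) * alt_indep (adj G) (?V R)"
    using insert.prems by (intro insert.IH) auto
  then show ?case
    unfolding V step using odd by simp
qed

lemma alt_indep_induced_subgraph:
  "alt_indep (adj (induced_subgraph G S)) (verts (induced_subgraph G S)) = alt_indep (adj G) (verts G \<inter> S)"
  unfolding verts_induced_subgraph by (rule alt_indep_cong) auto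

lemma verts_remove_branches [simp]:
  "verts (remove_branches G u R) = verts G - ((\<Union>p\<in>R. set p) - {u})"
  by (auto simp: remove_branches_def del_verts_def)

lemma alt_indep_of_remove_branches:
  "alt_indep (adj (remove_branches G u R)) (verts (remove_branches G u R)) =
     alt_indep (adj G) (verts G - ((\<Union>p\<in>R. set p) - {u}))"
proof -
  have "verts G \<inter> (verts G - ((\<Union>p\<in>R. set p) - {u})) = verts G - ((\<Union>p\<in>R. set p) - {u})"
    by auto
  then show ?thesis
    unfolding remove_branches_def del_verts_def alt_indep_induced_subgraph by simp
qed

lemma simple_graph_move: "move G b H \<Longrightarrow> simple_graph G \<Longrightarrow> simple_graph H"
  by (induction rule: move.induct)
    (auto simp: remove_branches_def del_verts_def simple_graph_induced_subgraph)

lemma alt_indep_move: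
  assumes "move G b H" "simple_graph G"
  shows "alt_indep (adj G) (verts G) = (if b then - 1 else 1) * alt_indep (adj H) (verts H)"
  using assms
proof (induction rule: move.induct)
  case (types_1_2 G u p q)
  note G = types_1_2.prems
  note E = symp_adj[of G] irreflp_adj[OF G]
  have p: "pure_branch G u p" "length (tl p) mod 3 = 1"
    and q: "pure_branch G u q" "length (tl q) mod 3 = 2"
    using branches_of_typeD[OF types_1_2.hyps(2)] branches_of_typeD[OF types_1_2.hyps(3)] by auto
  have "p \<noteq> q"
    using p q by auto
  then have disj: "set (tl p) \<inter> set (tl q) = {}"
    using pure_branches_disjoint[OF G p(1) q(1)] by simp
  \<comment> \<open>The base set is left open because the fact serves twice: with everything outside
    the two branches for \<open>G\<close>, and with \<open>{u}\<close> for the graph after the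
    move.\<close>
  have zero: "alt_indep (adj G) (Y \<union> set (tl p) \<union> set (tl q)) = 0"
    if Y: "Y \<subseteq> verts G" "Y \<inter> set (tl p) = {}" "Y \<inter> set (tl q) = {}" for Y
  proof (rule alt_indep_types_1_2[OF E])
    show "finite Y"
      using Y(1) G finite_subset by (auto simp: simple_graph_def)
    show "attached (adj G) Y u (tl p)" "attached (adj G) (Y \<union> set (tl p)) u (tl q)"
      using Y disj by (auto intro!: pure_branch_attached[OF G] p(1) q(1))
  qed (use p q set_pure_branch(2)[OF G] in auto)
  have sub: "set (tl p) \<subseteq> verts G" "set (tl q) \<subseteq> verts G" "u \<in> verts G"
    using pure_branchD(4,5)[OF G p(1)] pure_branchD(4)[OF G q(1)]
      set_pure_branch(1)[OF G p(1)] set_pure_branch(1)[OF G q(1)] by auto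
  have "verts G = verts G - set (tl p) - set (tl q) \<union> set (tl p) \<union> set (tl q)"
    using sub by auto
  then have "alt_indep (adj G) (verts G) = 0"
    using zero[of "verts G - set (tl p) - set (tl q)"] by auto
  moreover have "verts G \<inter> (set p \<union> set q) = {u} \<union> set (tl p) \<union> set (tl q)"
    using sub set_pure_branch(1)[OF G p(1)] set_pure_branch(1)[OF G q(1)] by auto
  then have "alt_indep (adj G) (verts G \<inter> (set p \<union> set q)) = 0"
    using zero[of "{u}"] sub set_pure_branch(2)[OF G p(1)] set_pure_branch(2)[OF G q(1)] by auto
  ultimately show ?case
    unfolding alt_indep_induced_subgraph by simp
next
  case (same_type G u t p R)
  have "alt_indep (adj G) (verts G) =
      (if odd_removal t R then - 1 else 1) * alt_indep (adj G) (verts G - ((\<Union>p\<in>R. set p) - {u}))"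
    using same_type finite_branches_of_type[of G u t]
    by (intro alt_indep_remove_branches[where ?p0.0 = p]) auto
  then show ?case
    unfolding alt_indep_of_remove_branches .
next
  case (type_0 G u R)
  have "alt_indep (adj G) (verts G) =
      (if odd_removal 0 R then - 1 else 1) * alt_indep (adj G) (verts G - ((\<Union>p\<in>R. set p) - {u}))"
    using type_0 finite_branches_of_type[of G u 0] finite_subset
    by (intro alt_indep_remove_branches) auto
  then show ?case
    unfolding alt_indep_of_remove_branches .
qed

lemma alt_indep_moves:
  assumes "moves G k H" "simple_graph G"
  shows "simple_graph H \<and> alt_indep (adj G) (verts G) = (- 1) ^ k * alt_indep (adj H) (verts H)"
  using assms
proof (induction rule: moves.induct)
  case (step G k H b K)
  then show ?case
    using simple_graph_move[OF step.hyps(2)] alt_indep_move[OF step.hyps(2)] by simp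
qed simp

section \<open>Values of path graphs\<close>

lemma adj_path_graph:
  "adj (path_graph n) i j \<longleftrightarrow> i < n \<and> j < n \<and> (j = Suc i \<or> i = Suc j)"
  by (auto simp: adj_def path_graph_def doubleton_eq_iff)

lemma alt_indep_path_graph: "alt_indep (adj (path_graph n)) (verts (path_graph n)) = period_six (n + 2)"
proof -
  \<comment> \<open>One infinite path on the naturals contains all the \<open>path_graph n\<close>,
    so the induction can keep the relation fixed.\<close>
  let ?E = "\<lambda>i j :: nat. j = Suc i \<or> i = Suc j"
  have E: "symp ?E" "irreflp ?E"
    by (auto intro!: sympI irreflpI)
  have "alt_indep ?E {..<n} = period_six (n + 2)"
  proof (induction n rule: less_induct)
    case (less n)
    show ?case
    proof (cases n)
      case 0
      have "{S :: nat set. S \<subseteq> {} \<and> (\<forall>u\<in>S. \<forall>v\<in>S. \<not> ?E u v)} = {{}}"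
        by auto
      then show ?thesis
        by (simp add: 0 alt_indep_def)
    next
      case (Suc m)
      \<comment> \<open>For \<open>m = 0\<close> the truncated difference gives the empty set on
        both sides, and the single vertex correctly gets 1 - 1 = 0.\<close>
      have "{..<m} - {y. ?E m y} = {..<m - 1}"
        by auto
      then have "alt_indep ?E {..<n} = alt_indep ?E {..<m} - alt_indep ?E {..<m - 1}"
        using alt_indep_insert[of "{..<m}" m ?E] E by (simp add: Suc lessThan_Suc)
      then show ?thesis
        using less.IH[of m] less.IH[of "m - 1"] by (cases m) (simp_all add: Suc)
    qed
  qed
  moreover have "alt_indep (adj (path_graph n)) {..<n} = alt_indep ?E {..<n}"
    by (rule alt_indep_cong) (auto simp: adj_path_graph)
  ultimately show ?thesis
    by (simp add: path_graph_def)
qed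

section \<open>Reducing a tree to a path\<close>

lemma is_path_take: "is_path G p \<Longrightarrow> n > 0 \<Longrightarrow> is_path G (take n p)"
  unfolding is_path_def
  by (metis append_take_drop_id distinct_take gr_implies_not_zero order_trans set_take_subset
      successively_append_iff take_eq_Nil)

lemma is_path_drop: "is_path G p \<Longrightarrow> n < length p \<Longrightarrow> is_path G (drop n p)"
  unfolding is_path_def
  by (metis append_take_drop_id distinct_drop drop_eq_Nil not_le order_trans set_drop_subset
      successively_append_iff)

lemma adj_nth_Suc:
  assumes "is_path G p" "Suc i < length p"
  shows "adj G (p ! i) (p ! Suc i)"
  using assms by (simp add: is_path_def successively_conv_nth)

lemma is_path_append1:
  assumes "is_path G p" "simple_graph G" "adj G (last p) y" "y \<notin> set p"
  shows "is_path G (p @ [y])"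
  using assms adj_verts(2)[OF assms(2,3)] by (auto simp: is_path_def successively_append_iff)

lemma is_path_Cons:
  assumes "is_path G p" "simple_graph G" "adj G y (hd p)" "y \<notin> set p"
  shows "is_path G (y # p)"
  using assms adj_verts(1)[OF assms(2,3)] by (cases p) (auto simp: is_path_def)

lemma length_path_le: "is_path G p \<Longrightarrow> simple_graph G \<Longrightarrow> length p \<le> card (verts G)"
  by (metis card_mono distinct_card is_path_def simple_graph_def)

text \<open>Any other edge between path vertices closes the segment between them to a cycle of at
  least three vertices.\<close>

lemma tree_path_chordless:
  assumes G: "tree G" and p: "is_path G p" and ij: "i < j" "j < length p" and "adj G (p ! i) (p ! j)"
  shows "j = Suc i"
proof (rule ccontr)
  assume "j \<noteq> Suc i"
  let ?c = "drop i (take (Suc j) p)"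
  have "is_path G ?c"
    using p ij by (intro is_path_drop is_path_take) auto
  moreover have "length ?c \<ge> 3"
    using ij \<open>j \<noteq> Suc i\<close> by simp
  moreover have "hd ?c = p ! i"
    using ij by (simp add: hd_drop_conv_nth)
  moreover have "last ?c = p ! j"
    using ij by (simp add: take_Suc_conv_app_nth last_drop)
  ultimately have "is_cycle G ?c"
    using assms(5) adj_sym by (metis is_cycle_def)
  then show False
    using G by (auto simp: tree_def)
qed

lemma tree_last_neighbour:
  assumes G: "tree G" and p: "is_path G p" and x: "x \<in> set p" "adj G (last p) x"
  shows "length p \<ge> 2 \<and> x = p ! (length p - 2)"
proof -
  obtain i where i: "i < length p" "x = p ! i"
    using x(1) by (metis in_set_conv_nth)
  have l: "last p = p ! (length p - 1)"
    using i by (metis last_conv_nth length_greater_0_conv less_nat_zero_code list.size(3))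
  have "last p \<noteq> x"
    using G adj_verts(3)[OF _ x(2)] by (simp add: tree_def)
  then have "i < length p - 1"
    using i l by (cases "i = length p - 1") auto
  moreover have "adj G (p ! i) (p ! (length p - 1))"
    using x(2) i(2) l adj_sym by metis
  ultimately have "length p - 1 = Suc i"
    using tree_path_chordless[OF G p] i by simp
  then have "length p - 2 = i" "length p \<ge> 2"
    by auto
  then show ?thesis
    using i(2) by simp
qed

section \<open>Cutting off a vertex set that hangs at one vertex\<close>

lemma successively_closed:
  assumes "successively R xs" "xs \<noteq> []" "hd xs \<in> A"
    and "\<And>x y. x \<in> A \<Longrightarrow> y \<in> set xs \<Longrightarrow> R x y \<Longrightarrow> y \<in> A"
  shows "set xs \<subseteq> A"
  using assms
proof (induction xs rule: induct_list012)
  case (2 x)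
  then show ?case
    by simp
next
  case (3 x y zs)
  have "y \<in> A"
    using "3.prems"(4)[of x y] "3.prems"(1,3) by simp
  have "set (y # zs) \<subseteq> A"
  proof (rule "3.IH"(2))
    fix a b assume "a \<in> A" "b \<in> set (y # zs)" "R a b"
    then show "b \<in> A"
      using "3.prems"(4)[of a b] by simp
  qed (use "3.prems"(1) \<open>y \<in> A\<close> in simp_all)
  then show ?case
    using "3.prems"(3) by simp
qed simp

text \<open>A path can enter \<open>T\<close> only from \<open>u\<close> and leave it only to
  \<open>u\<close>. Having used \<open>u\<close> to get in, it would have to end inside
  \<open>T\<close>.\<close>

lemma path_avoids_appendage:
  assumes T: "\<And>y z. y \<in> T \<Longrightarrow> z \<notin> T \<Longrightarrow> adj G y z \<Longrightarrow> z = u"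
    and r: "is_path G r" "hd r \<notin> T" "last r \<notin> T"
  shows "set r \<inter> T = {}"
proof (rule ccontr)
  assume "set r \<inter> T \<noteq> {}"
  then obtain b y c where b: "r = b @ y # c" "y \<in> T" "\<forall>z\<in>set b. z \<notin> T"
    using split_list_first_prop[of r "\<lambda>z. z \<in> T"] by blast
  have "b \<noteq> []"
    using b r(2) by auto
  have "adj G y (last b)"
    using r(1) b(1) \<open>b \<noteq> []\<close> adj_sym by (fastforce simp: is_path_def successively_append_iff)
  then have "last b = u"
    using T b \<open>b \<noteq> []\<close> by auto
  then have "u \<notin> set (y # c)"
    using r(1) b(1) \<open>b \<noteq> []\<close> last_in_set[of b] by (auto simp: is_path_def)
  moreover have "successively (adj G) (y # c)"
    using r(1) b(1) by (simp add: is_path_def successively_append_iff)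
  ultimately have "last (y # c) \<in> T"
    using successively_closed[of "adj G" "y # c" T] b(2) T by (metis last_in_set list.discI list.sel(1) subsetD)
  then show False
    using b(1) r(3) by simp
qed

text \<open>Connectedness is the point: a path of \<open>G\<close> between surviving vertices avoids
  \<open>T\<close>, hence survives. \<open>T\<close> may be a union of branches or, for moves of
  kind (1), everything outside two branches.\<close>

lemma tree_delete_appendage:
  assumes G: "tree G" and T: "\<And>y z. y \<in> T \<Longrightarrow> z \<notin> T \<Longrightarrow> adj G y z \<Longrightarrow> z = u"
    and u: "u \<in> verts G" "u \<notin> T"
  shows "tree (induced_subgraph G (verts G - T))"
proof -
  let ?H = "induced_subgraph G (verts G - T)"
  have path: "is_path ?H p \<longleftrightarrow> is_path G p \<and> set p \<inter> T = {}" for p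
    unfolding is_path_def
    by (auto simp: successively_conv_nth subset_eq disjoint_iff)
  have "\<exists>p. is_path ?H p \<and> hd p = a \<and> last p = b" if "a \<in> verts ?H" "b \<in> verts ?H" for a b
  proof -
    have "a \<in> verts G" "b \<in> verts G"
      using that by auto
    then obtain p where "is_path G p" "hd p = a" "last p = b"
      using G unfolding tree_def connected_graph_def by blast
    moreover from this have "set p \<inter> T = {}"
      using that by (intro path_avoids_appendage[of T G u, OF T]) auto
    ultimately show ?thesis
      using path by blast
  qed
  moreover have "\<not> is_cycle ?H c" for c
    using G path by (auto simp: tree_def is_cycle_def)
  ultimately show ?thesis
    using G u by (auto simp: tree_def connected_graph_def simple_graph_induced_subgraph)
qed

lemma tree_remove_branches:
  assumes G: "tree G" and R: "\<And>p. p \<in> R \<Longrightarrow> pure_branch G u p" and u: "u \<in> verts G"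
  shows "tree (remove_branches G u R)"
proof -
  have G': "simple_graph G"
    using G by (simp add: tree_def)
  have "tree (induced_subgraph G (verts G - (\<Union>p\<in>R. set (tl p))))"
  proof (rule tree_delete_appendage[OF G _ u])
    fix y z
    assume y: "y \<in> (\<Union>p\<in>R. set (tl p))" and z: "z \<notin> (\<Union>p\<in>R. set (tl p))" and yz: "adj G y z"
    then obtain p where "p \<in> R" "y \<in> set (tl p)"
      by blast
    then show "z = u"
      using pure_branch_adj(1)[OF G' R _ _ yz] z by blast
  qed (use set_pure_branch(2)[OF G' R] in auto)
  then show ?thesis
    using Union_pure_branches[of G R u] G' R by (simp add: remove_branches_def del_verts_def)
qed

lemma tree_move:
  assumes "move G b H" "tree G"
  shows "tree H"
  using assms
proof (induction rule: move.induct)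
  case (types_1_2 G u p q)
  have G: "simple_graph G"
    using types_1_2.prems by (simp add: tree_def)
  have p: "pure_branch G u p" and q: "pure_branch G u q"
    using branches_of_typeD(1)[OF types_1_2.hyps(2)] branches_of_typeD(1)[OF types_1_2.hyps(3)]
    by auto
  let ?S = "set p \<union> set q"
  have "tree (induced_subgraph G (verts G - (verts G - ?S)))"
  proof (rule tree_delete_appendage[OF types_1_2.prems])
    fix y z assume yz: "y \<in> verts G - ?S" "z \<notin> verts G - ?S" "adj G y z"
    then have "z \<in> ?S" "adj G z y"
      using adj_verts(2)[OF G] adj_sym[of G y z] by auto
    \<comment> \<open>Otherwise \<open>z\<close> lies inside a branch, and its neighbour
      \<open>y\<close> outside would have to be \<open>u\<close>, which belongs to
      \<open>?S\<close>.\<close>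
    then show "z = u"
      using yz(1) pure_branch_adj[OF G p] pure_branch_adj[OF G q]
        set_pure_branch(1)[OF G p] set_pure_branch(1)[OF G q] by auto
  qed (use pure_branchD[OF G p] set_pure_branch(1)[OF G p] in auto)
  moreover have "verts G - (verts G - ?S) = ?S"
    using pure_branchD(4)[OF G p] pure_branchD(4)[OF G q] by auto
  ultimately show ?case
    by simp
next
  case (same_type G u t p R)
  show ?case
  proof (rule tree_remove_branches[OF same_type.prems])
    show "pure_branch G u q" if "q \<in> R" for q
      using that same_type.hyps(5) branches_of_typeD(1)[of q G u t] by simp
  qed (use same_type.hyps(1) in \<open>simp add: branching_point_def\<close>)
next
  case (type_0 G u R)
  show ?case
  proof (rule tree_remove_branches[OF type_0.prems])
    show "pure_branch G u q" if "q \<in> R" for q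
      using that type_0.hyps(2) branches_of_typeD(1)[of q G u 0] by blast
  qed (use type_0.hyps(1) in \<open>simp add: branching_point_def\<close>)
qed

section \<open>Extremal paths in trees\<close>

lemma longest_path_exists:
  assumes G: "simple_graph G" and p: "is_path G p" "P p"
  shows "\<exists>q. is_path G q \<and> P q \<and> (\<forall>r. is_path G r \<longrightarrow> P r \<longrightarrow> length r \<le> length q)"
proof -
  have "\<forall>r. is_path G r \<and> P r \<longrightarrow> length r \<le> card (verts G)"
    using length_path_le[OF _ G] by blast
  with p have "\<exists>q. (is_path G q \<and> P q) \<and> (\<forall>r. is_path G r \<and> P r \<longrightarrow> length r \<le> length q)"
    by (intro ex_has_greatest_nat[where k = p and b = "Suc (card (verts G))" and f = length]) (auto simp: less_Suc_eq_le)
  then show ?thesis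
    by blast
qed

text \<open>A longest path is closed under adjacency: an outside neighbour of an end would lengthen
  it, and one of an inner vertex would give degree 3. So it covers the connected graph, and having
  no chords it is the whole graph.\<close>

lemma tree_without_branching_point:
  assumes G: "tree G" and nb: "\<And>u. \<not> branching_point G u"
  shows "\<exists>n. graph_iso G (path_graph n)"
proof -
  have sg: "simple_graph G"
    using G by (simp add: tree_def)
  obtain v where "v \<in> verts G"
    using G by (auto simp: tree_def connected_graph_def)
  then have "is_path G [v]"
    by (simp add: is_path_def)
  then obtain p where p: "is_path G p" and longest: "\<And>q. is_path G q \<Longrightarrow> length q \<le> length p"
    using longest_path_exists[OF sg, of "[v]" "\<lambda>_. True"] by auto
  have p': "p \<noteq> []" "distinct p" "set p \<subseteq> verts G"
    using p by (auto simp: is_path_def)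
  have closed: "z \<in> set p" if yz: "y \<in> set p" "adj G y z" for y z
  proof (rule ccontr)
    assume z: "z \<notin> set p"
    obtain i where i: "i < length p" "y = p ! i"
      using yz(1) by (metis in_set_conv_nth)
    have "i \<noteq> 0"
    proof
      assume "i = 0"
      then have "is_path G (z # p)"
        using i p'(1) z yz(2) adj_sym[of G y z]
        by (intro is_path_Cons[OF p sg]) (auto simp: hd_conv_nth)
      then show False
        using longest by fastforce
    qed
    moreover have "i \<noteq> length p - 1"
    proof
      assume "i = length p - 1"
      then have "is_path G (p @ [z])"
        using i p'(1) z yz(2) by (intro is_path_append1[OF p sg]) (auto simp: last_conv_nth)
      then show False
        using longest by fastforce
    qed
    ultimately have ii: "i > 0" "Suc i < length p"
      using i(1) by auto
    let ?a = "p ! (i - 1)" and ?b = "p ! Suc i"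
    have "adj G y ?a" "adj G y ?b"
      using adj_nth_Suc[OF p, of "i - 1"] adj_nth_Suc[OF p, of i] ii i adj_sym[of G y ?a] by auto
    moreover have "?a \<noteq> ?b"
      using p'(2) ii by (simp add: nth_eq_iff_index_eq)
    moreover have "?a \<in> set p" "?b \<in> set p"
      using ii by auto
    then have "?a \<noteq> z" "?b \<noteq> z"
      using z by metis+
    ultimately have "{?a, ?b, z} \<subseteq> {x. adj G y x}" "card {?a, ?b, z} = 3"
      using yz(2) by simp_all
    then have "deg G y \<ge> 3"
      using card_mono[OF finite_neighbours[OF sg, of y]] unfolding deg_def by metis
    then show False
      using nb[of y] yz(1) p'(3) by (auto simp: branching_point_def)
  qed
  have verts: "verts G = set p"
  proof
    show "verts G \<subseteq> set p"
    proof
      fix b assume "b \<in> verts G"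
      then obtain r where r: "is_path G r" "hd r = hd p" "last r = b"
        using G p' by (metis connected_graph_def hd_in_set subsetD tree_def)
      have "set r \<subseteq> set p"
      proof (rule successively_closed[of "adj G"])
        show "successively (adj G) r" "r \<noteq> []" "hd r \<in> set p"
          using r(1,2) p'(1) by (simp_all add: is_path_def)
      qed (rule closed)
      moreover have "b \<in> set r"
        using r(1,3) by (auto simp: is_path_def)
      ultimately show "b \<in> set p"
        by blast
    qed
  qed (rule p'(3))
  let ?n = "length p"
  have bij: "bij_betw ((!) p) {..<?n} (verts G)"
    using p'(2) verts by (intro bij_betw_nth) auto
  let ?f = "inv_into {..<?n} ((!) p)"
  have f: "?f (p ! i) = i" if "i < ?n" for i
    using bij that by (simp add: bij_betw_def inv_into_f_f)
  have "adj G u v \<longleftrightarrow> adj (path_graph ?n) (?f u) (?f v)" if uv: "u \<in> verts G" "v \<in> verts G" for u v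
  proof -
    obtain i j where ij: "i < ?n" "u = p ! i" "j < ?n" "v = p ! j"
      using uv verts by (metis in_set_conv_nth)
    have "adj G (p ! i) (p ! j) \<longleftrightarrow> j = Suc i \<or> i = Suc j"
    proof
      assume adj: "adj G (p ! i) (p ! j)"
      consider "i < j" | "j < i" | "i = j"
        by linarith
      then show "j = Suc i \<or> i = Suc j"
      proof cases
        case 1
        then show ?thesis
          using tree_path_chordless[OF G p _ _ adj] ij by simp
      next
        case 2
        have "adj G (p ! j) (p ! i)"
          using adj adj_sym[of G "p ! i" "p ! j"] by simp
        then show ?thesis
          using tree_path_chordless[OF G p 2] ij by simp
      next
        case 3
        then show ?thesis
          using adj_verts(3)[OF sg adj] by simp
      qed
    next
      assume "j = Suc i \<or> i = Suc j"
      then show "adj G (p ! i) (p ! j)"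
        using adj_nth_Suc[OF p] ij adj_sym[of G "p ! i" "p ! j"] by auto
    qed
    then show ?thesis
      using ij f by (simp add: adj_path_graph)
  qed
  moreover have "bij_betw ?f (verts G) (verts (path_graph ?n))"
    using bij_betw_inv_into[OF bij] by (simp add: path_graph_def)
  ultimately show ?thesis
    unfolding graph_iso_def by blast
qed

text \<open>The last vertex of a longest path joining two branching points: every maximal extension
  beyond it meets no further branching point, hence runs along a pure branch.\<close>

lemma tree_two_pure_branches:
  assumes G: "tree G" and r: "branching_point G r"
  obtains u p q where "pure_branch G u p" "pure_branch G u q" "p \<noteq> q"
proof -
  have sg: "simple_graph G"
    using G by (simp add: tree_def)
  \<comment> \<open>Only the end of the path is required to branch, so \<open>[r]\<close> is a
    candidate.\<close>
  let ?P = "\<lambda>w. is_path G w \<and> branching_point G (last w)"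
  have "?P [r]"
    using r by (simp add: is_path_def branching_point_def)
  then obtain w where w: "is_path G w" "branching_point G (last w)"
      and longest: "\<And>w'. ?P w' \<Longrightarrow> length w' \<le> length w"
    using longest_path_exists[OF sg, of "[r]" "\<lambda>w. branching_point G (last w)"] by auto
  define u where "u = last w"
  have w_eq: "w = butlast w @ [u]"
    using w(1) by (simp add: is_path_def u_def)
  have branch: "\<exists>q. pure_branch G u (u # x # q)" if x: "adj G u x" "x \<notin> set w" for x
  proof -
    let ?Q = "\<lambda>q. is_path G (w @ x # q)"
    have "?Q []"
      using is_path_append1[OF w(1) sg] x by (simp add: u_def)
    then obtain q where q: "?Q q" and longest_ext: "\<And>p'. is_path G p' \<Longrightarrow> \<exists>q'. p' = w @ x # q' \<Longrightarrow>
        length p' \<le> length (w @ x # q)"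
      using longest_path_exists[OF sg, of "w @ [x]" "\<lambda>p. \<exists>q. p = w @ x # q"] by blast
    have maximal: "length q' \<le> length q" if "?Q q'" for q'
      using longest_ext[OF that] by simp
    let ?p = "w @ x # q"
    let ?l = "last ?p"
    have len: "length ?p \<ge> 2" "?p \<noteq> []"
      using w_eq by (auto simp: Suc_le_eq)
    \<comment> \<open>Maximality excludes neighbours off the path and acyclicity excludes all but
      the predecessor on it, so the extension ends in a leaf.\<close>
    have "{y. adj G ?l y} = {?p ! (length ?p - 2)}"
    proof (intro equalityI subsetI)
      fix y assume "y \<in> {y. adj G ?l y}"
      then have y: "adj G ?l y"
        by simp
      have "y \<in> set ?p"
      proof (rule ccontr)
        assume "y \<notin> set ?p"
        then have "?Q (q @ [y])"
          using is_path_append1[OF q sg y] by simp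
        then show False
          using maximal by fastforce
      qed
      then show "y \<in> {?p ! (length ?p - 2)}"
        using tree_last_neighbour[OF G q _ y] by simp
    next
      fix y assume "y \<in> {?p ! (length ?p - 2)}"
      moreover have "adj G (?p ! (length ?p - 2)) (?p ! Suc (length ?p - 2))"
        using len by (intro adj_nth_Suc[OF q]) auto
      moreover have "Suc (length ?p - 2) = length ?p - 1"
        using len(1) by linarith
      then have "?p ! Suc (length ?p - 2) = ?l"
        using last_conv_nth[OF len(2)] by (simp only:)
      ultimately show "y \<in> {y. adj G ?l y}"
        using adj_sym[of G ?l y] by simp
    qed
    then have "deg G ?l = 1"
      by (simp add: deg_def)
    moreover have "?l \<in> verts G"
      using q len(2) last_in_set[of ?p] unfolding is_path_def by blast
    ultimately have "leaf G (last (u # x # q))"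
      by (simp add: leaf_def)
    moreover have "deg G v \<le> 2" if v: "v \<in> set (x # q)" for v
    proof (rule ccontr)
      assume "\<not> deg G v \<le> 2"
      then have "branching_point G v"
        using v q by (auto simp: branching_point_def is_path_def)
      moreover obtain a b where ab: "x # q = a @ v # b"
        using v by (meson split_list)
      \<comment> \<open>Stopping the extension at the branching point \<open>v\<close> gives a path
        longer than \<open>w\<close> that ends in a branching point.\<close>
      have "is_path G (take (length (w @ a @ [v])) ?p)"
        using q by (intro is_path_take) auto
      then have "is_path G (w @ a @ [v])"
        by (simp add: ab)
      ultimately have "?P (w @ a @ [v])"
        by simp
      then show False
        using longest by fastforce
    qed
    moreover have "is_path G (u # x # q)"
    proof -
      have "?p = butlast w @ u # x # q"
        using w_eq by (metis append.assoc append_Cons append_Nil)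
      moreover have "is_path G (drop (length (butlast w)) ?p)"
        using q w_eq by (intro is_path_drop) auto
      ultimately show ?thesis
        by (metis append_eq_conv_conj)
    qed
    ultimately have "pure_branch G u (u # x # q)"
      using w(2) by (auto simp: pure_branch_def u_def)
    then show ?thesis
      by blast
  qed
  \<comment> \<open>\<open>?a\<close> is the predecessor of \<open>u\<close> on \<open>w\<close>. If
    \<open>w\<close> is just \<open>[u]\<close>, the index truncates to 0 and \<open>?a\<close> is
    \<open>u\<close>, so no neighbour is lost.\<close>
  let ?N = "{v. adj G u v}" and ?a = "w ! (length w - 2)"
  have "card (?N - {?a}) \<ge> 2"
  proof -
    have "card ?N > 2"
      using w(2) by (simp add: branching_point_def deg_def u_def)
    moreover have "card ?N - card {?a} \<le> card (?N - {?a})"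
      by (intro diff_card_le_card_Diff) simp
    moreover have "card {?a} = 1"
      by simp
    ultimately show ?thesis
      by linarith
  qed
  then obtain T where T: "T \<subseteq> ?N - {?a}" "card T = 2"
    by (meson obtain_subset_with_card_n)
  then obtain x y where xy: "x \<noteq> y" "{x, y} \<subseteq> ?N - {?a}"
    by (metis card_2_iff)
  have "z \<notin> set w" if "z \<in> ?N - {?a}" for z
    using that tree_last_neighbour[OF G w(1)] by (auto simp: u_def)
  then obtain p q where "pure_branch G u (u # x # p)" "pure_branch G u (u # y # q)"
    using xy branch by (metis DiffD1 insert_subset mem_Collect_eq)
  then show ?thesis
    using that xy(1) by blast
qed

section \<open>Moves that shrink a tree\<close>

lemma card_remove_branches_less:
  assumes G: "simple_graph G" and R: "q \<in> R" "pure_branch G u q"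
  shows "card (verts (remove_branches G u R)) < card (verts G)"
proof (rule psubset_card_mono)
  have "hd (tl q) \<in> set (tl q)"
    using pure_branchD(2)[OF G R(2)] by simp
  then have "hd (tl q) \<in> set q - {u}" "hd (tl q) \<in> verts G"
    using set_pure_branch[OF G R(2)] pure_branchD(4)[OF G R(2)] by auto
  then show "verts (remove_branches G u R) \<subset> verts G"
    using R(1) by auto
qed (use G in \<open>simp add: simple_graph_def\<close>)

text \<open>Each branch contains only one neighbour of \<open>u\<close>, its first vertex, while
  \<open>u\<close> has at least three; some neighbour is therefore deleted.\<close>

lemma card_two_branches_less:
  assumes G: "simple_graph G" and p: "pure_branch G u p" and q: "pure_branch G u q"
  shows "card (verts (induced_subgraph G (set p \<union> set q))) < card (verts G)"
proof (rule psubset_card_mono)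
  have "\<not> {v. adj G u v} \<subseteq> set p \<union> set q"
  proof
    assume sub: "{v. adj G u v} \<subseteq> set p \<union> set q"
    have "v = hd (tl p) \<or> v = hd (tl q)" if v: "adj G u v" for v
    proof -
      have "v \<noteq> u" "adj G v u"
        using adj_verts(3)[OF G v] v adj_sym[of G u v] by auto
      moreover have "v \<in> set (tl p) \<or> v \<in> set (tl q)"
        using sub v \<open>v \<noteq> u\<close> set_pure_branch(1)[OF G p] set_pure_branch(1)[OF G q] by auto
      ultimately show ?thesis
        using pure_branch_adj(2)[OF G p] set_pure_branch(2)[OF G p]
          pure_branch_adj(2)[OF G q] set_pure_branch(2)[OF G q] by metis
    qed
    then have "{v. adj G u v} \<subseteq> {hd (tl p), hd (tl q)}"
      by blast
    then have "deg G u \<le> card {hd (tl p), hd (tl q)}"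
      unfolding deg_def by (intro card_mono) auto
    also have "\<dots> \<le> 2"
      by (simp add: card_insert_if)
    finally show False
      using p by (simp add: pure_branch_def branching_point_def)
  qed
  then show "verts (induced_subgraph G (set p \<union> set q)) \<subset> verts G"
    using adj_verts(2)[OF G] by auto
qed (use G in \<open>simp add: simple_graph_def\<close>)

text \<open>Two pure branches at one vertex always permit a move: a branch of type 0 can be removed,
  equal types permit (2), and otherwise the types are 1 and 2, which permits (1).\<close>

lemma tree_move_exists:
  assumes G: "tree G" and r: "branching_point G r"
  shows "\<exists>b H. move G b H \<and> card (verts H) < card (verts G)"
proof -
  have sg: "simple_graph G"
    using G by (simp add: tree_def)
  obtain u p q where pq: "pure_branch G u p" "pure_branch G u q" "p \<noteq> q"
    using tree_two_pure_branches[OF G r] .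
  have u: "branching_point G u"
    using pq(1) by (simp add: pure_branch_def)
  have type_0: ?thesis if "pure_branch G u p" "branch_type p = 0" for p
  proof -
    have "move G (odd_removal 0 {p}) (remove_branches G u {p})"
      using that by (intro move.type_0[OF u]) (auto simp: branches_of_type_def)
    then show ?thesis
      using card_remove_branches_less[OF sg _ that(1), of "{p}"] by blast
  qed
  have types_1_2: ?thesis
    if "pure_branch G u p" "branch_type p = 1" "pure_branch G u q" "branch_type q = 2" for p q
  proof -
    have "move G False (induced_subgraph G (set p \<union> set q))"
      using that by (intro move.types_1_2[OF u]) (auto simp: branches_of_type_def)
    then show ?thesis
      using card_two_branches_less[OF sg that(1,3)] by blast
  qed
  have same: ?thesis if "branch_type q = branch_type p"
  proof -
    let ?B = "branches_of_type G u (branch_type p)"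
    have "{p, q} \<subseteq> ?B"
      using pq that by (auto simp: branches_of_type_def)
    then have "card {p, q} \<le> card ?B"
      by (intro card_mono finite_branches_of_type[OF sg])
    moreover have "branch_type p \<in> {0, 1, 2}"
      by (auto simp: branch_type_def)
    ultimately have "move G (odd_removal (branch_type p) (?B - {p})) (remove_branches G u (?B - {p}))"
      using \<open>{p, q} \<subseteq> ?B\<close> pq(3) by (intro move.same_type[OF u, where p = p]) auto
    moreover have "q \<in> ?B - {p}"
      using \<open>{p, q} \<subseteq> ?B\<close> pq(3) by auto
    ultimately show ?thesis
      using card_remove_branches_less[OF sg _ pq(2), of "?B - {p}"] by blast
  qed
  have "branch_type p \<in> {0, 1, 2}" "branch_type q \<in> {0, 1, 2}"
    by (auto simp: branch_type_def)
  then show ?thesis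
    using type_0[OF pq(1)] type_0[OF pq(2)] types_1_2[OF pq(1) _ pq(2)] types_1_2[OF pq(2) _ pq(1)] same
    by auto
qed

text \<open>\<open>moves\<close> grows at its far end, whereas the induction on the size of the tree
  splits off the first move.\<close>

lemma moves_Cons:
  assumes "moves H k K" "move G b H"
  shows "moves G (k + of_bool b) K"
  using assms
proof (induction rule: moves.induct)
  case (refl H)
  then show ?case
    using moves.step[OF moves.refl refl.prems] by simp
next
  case (step H k K b' L)
  have "moves G (k + of_bool b + of_bool b') L"
    using moves.step[OF step.IH[OF step.prems] step.hyps(2)] .
  then show ?case
    by (simp add: ac_simps)
qed

lemma tree_reducible_to_path:
  assumes "tree G"
  shows "\<exists>k n. reducible_with G k (path_graph n)"
  using assms
proof (induction "card (verts G)" arbitrary: G rule: less_induct)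
  case less
  show ?case
  proof (cases "\<exists>r. branching_point G r")
    case True
    then obtain b H where H: "move G b H" "card (verts H) < card (verts G)"
      using tree_move_exists[OF less.prems] by blast
    then obtain k n K where "moves H k K" "graph_iso K (path_graph n)"
      using less.hyps[OF H(2) tree_move[OF H(1) less.prems]] by (auto simp: reducible_with_def)
    then show ?thesis
      using moves_Cons[OF _ H(1)] unfolding reducible_with_def by blast
  next
    case False
    then show ?thesis
      using tree_without_branching_point[OF less.prems] moves.refl unfolding reducible_with_def by blast
  qed
qed

section \<open>From reductions to the value at -1\<close>

lemma poly_indep_poly_reducible:
  assumes G: "simple_graph G" and red: "reducible_with G k (path_graph n)"
  shows "poly (indep_poly G) (- 1) = (- 1) ^ k * period_six (n + 2)"
proof -
  obtain K where K: "moves G k K" "graph_iso K (path_graph n)"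
    using red by (auto simp: reducible_with_def)
  then show ?thesis
    using alt_indep_moves[OF K(1) G] alt_indep_graph_iso[OF K(2)] alt_indep_path_graph[of n]
      poly_indep_poly_minus_one[of G] G by (simp add: simple_graph_def)
qed

theorem theorem1p4:
  fixes G :: "'a ugraph"
  assumes "tree G"
  shows "(poly (indep_poly G) (- 1) = 1 \<longleftrightarrow>
            (\<exists>n. n mod 6 \<in> {5, 0} \<and> reducible_by_even G (path_graph n)) \<or>
            (\<exists>n. n mod 6 \<in> {2, 3} \<and> reducible_by_odd G (path_graph n)))
       \<and> (poly (indep_poly G) (- 1) = - 1 \<longleftrightarrow>
            (\<exists>n. n mod 6 \<in> {5, 0} \<and> reducible_by_odd G (path_graph n)) \<or>
            (\<exists>n. n mod 6 \<in> {2, 3} \<and> reducible_by_even G (path_graph n)))"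
proof -
  have sg: "simple_graph G"
    using assms by (simp add: tree_def)
  have per: "period_six (n + 2) =
      (if n mod 6 \<in> {5, 0} then 1 else if n mod 6 \<in> {2, 3} then - 1 else 0)" for n
  proof -
    have "n mod 6 = 5 \<or> n mod 6 = 0 \<longleftrightarrow> (n + 2) mod 6 = 1 \<or> (n + 2) mod 6 = 2"
      "n mod 6 = 2 \<or> n mod 6 = 3 \<longleftrightarrow> (n + 2) mod 6 = 4 \<or> (n + 2) mod 6 = 5"
      by presburger+
    then show ?thesis
      by (simp only: period_six_eq insert_iff empty_iff simp_thms)
  qed
  let ?v = "poly (indep_poly G) (- 1)"
  let ?L = "(\<exists>n. n mod 6 \<in> {5, 0} \<and> reducible_by_even G (path_graph n)) \<or>
            (\<exists>n. n mod 6 \<in> {2, 3} \<and> reducible_by_odd G (path_graph n))"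
  let ?R = "(\<exists>n. n mod 6 \<in> {5, 0} \<and> reducible_by_odd G (path_graph n)) \<or>
            (\<exists>n. n mod 6 \<in> {2, 3} \<and> reducible_by_even G (path_graph n))"
  have even: "?v = (if n mod 6 \<in> {5, 0} then 1 else if n mod 6 \<in> {2, 3} then - 1 else 0)"
    if "reducible_by_even G (path_graph n)" for n
    unfolding per[symmetric] using that poly_indep_poly_reducible[OF sg]
    by (auto simp: reducible_by_even_def simp del: period_six.simps)
  have odd: "?v = - (if n mod 6 \<in> {5, 0} then 1 else if n mod 6 \<in> {2, 3} then - 1 else 0)"
    if "reducible_by_odd G (path_graph n)" for n
    unfolding per[symmetric] using that poly_indep_poly_reducible[OF sg]
    by (auto simp: reducible_by_odd_def simp del: period_six.simps)
  have L: "?v = 1" if ?L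
    using that
  proof (elim disjE exE conjE)
    fix n assume "n mod 6 \<in> {5, 0}" "reducible_by_even G (path_graph n)"
    then show ?thesis
      using even[of n] by simp
  next
    fix n assume "n mod 6 \<in> {2, 3}" "reducible_by_odd G (path_graph n)"
    then show ?thesis
      using odd[of n] by auto
  qed
  have R: "?v = - 1" if ?R
    using that
  proof (elim disjE exE conjE)
    fix n assume "n mod 6 \<in> {5, 0}" "reducible_by_odd G (path_graph n)"
    then show ?thesis
      using odd[of n] by simp
  next
    fix n assume "n mod 6 \<in> {2, 3}" "reducible_by_even G (path_graph n)"
    then show ?thesis
      using even[of n] by auto
  qed
  obtain k n where "reducible_with G k (path_graph n)"
    using tree_reducible_to_path[OF assms] by blast
  then have "reducible_by_even G (path_graph n) \<or> reducible_by_odd G (path_graph n)"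
    unfolding reducible_by_even_def reducible_by_odd_def by blast
  \<comment> \<open>The one reduction at hand decides the case; a path with \<open>n mod 6\<close>
    equal to 1 or 4 forces the value 0.\<close>
  then have LR: "?L \<or> ?R \<or> ?v = 0"
  proof (cases "n mod 6 \<in> {5, 0} \<or> n mod 6 \<in> {2, 3}")
    case False
    then show ?thesis
      using \<open>reducible_by_even G (path_graph n) \<or> reducible_by_odd G (path_graph n)\<close>
        even[of n] odd[of n] by auto
  next
    case True
    then show ?thesis
      using \<open>reducible_by_even G (path_graph n) \<or> reducible_by_odd G (path_graph n)\<close> by metis
  qed
  \<comment> \<open>The values 1, -1 and 0 exclude one another, so two implications and one
    exhaustive disjunction yield both equivalences.\<close>
  have "(v = 1 \<longleftrightarrow> P) \<and> (v = - 1 \<longleftrightarrow> Q)"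
    if "P \<Longrightarrow> v = 1" "Q \<Longrightarrow> v = - 1" "P \<or> Q \<or> v = 0" for P Q and v :: int
    using that by auto
  from this[OF L R LR] show ?thesis .
qed

end
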